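(* Let $\mathfrak{n}$ be a uniform Lie algebra of type $(p,q,r)$ with degree $s$ and uniform basis $\mathcal{B}=\{v_i\}_{i=1}^q\cup\{z_j\}_{j=1}^p$. Then the directed colored graph associated to $\mathfrak{n}$ (and $\mathcal{B}$) is a uniformly colored graph of type $(p,q,r)$ with degree $s$.
   Context: All Lie algebras are finite-dimensional over $\mathbb{R}$. Let $p,q,r$ be positive integers. A nilpotent Lie algebra $\mathfrak{n}$ is uniform of type $(p,q,r)$ if there exist a basis $\mathcal{B}=\{v_i\}_{i=1}^q\cup\{z_j\}_{j=1}^p$ of $\mathfrak{n}$ (a uniform basis) and a positive integer $s$ (the degree) such that: (i) for all $i,j\in\{1,\dots,q\}$ and $l,m\in\{1,\dots,p\}$, $[v_i,z_l]=0$, $[z_l,z_m]=0$ and $[v_i,v_j]\in\{0,\pm z_1,\dots,\pm z_p\}$; (ii) if $[v_i,v_j]$ is nonzero and $[v_i,v_j]=\pm[v_i,v_k]$, then $v_j=v_k$; (iii) for every $l$ there are exactly $r$ pairs $\{v_i,v_j\}$ (necessarily disjoint) with $[v_i,v_j]=z_l$ for one of the two orderings of the pair; (iv) for every $j$ there are exactly $s$ basis vectors $v_i$ with $[v_i,v_j]\neq 0$. The associated directed colored graph has vertex set $V=\{v_i\}_{i=1}^q$, edge set $E=\{(v_i,v_j): [v_i,v_j]=z_k\text{ for some }k\}$, and coloring $c:E\to\{z_j\}_{j=1}^p$ with $c(v_i,v_j)=z_k$ when $[v_i,v_j]=z_k$. Graphs have no loops or multiple edges. A uniform edge coloring of type $(p,q,r)$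 with degree $s$ on an undirected $s$-regular graph $(V,E)$ with $q$ vertices is a surjective map $c:E\to S$, $|S|=p$, such that adjacent edges have different colors (the coloring is proper) and $|c^{-1}(\{k\})|=r$ for every $k\in S$. A directed graph is a uniformly colored graph of type $(p,q,r)$ with degree $s$ if it is an undirected graph with such a coloring, endowed with an orientation (so $(v,w)$ and $(w,v)$ are never both edges). *)

theory Defs
  imports "HOL-Analysis.Analysis" "Graph_Theory.Pair_Digraph"
begin

section \<open>Finite-dimensional real Lie algebras\<close>

text \<open>The underlying vector space is a whole type of class \<open>real_vector\<close>.\<close>

locale fin_dim_real_lie_algebra =
  fixes br :: "'n::real_vector \<Rightarrow> 'n \<Rightarrow> 'n"
  assumes bilinear: "bilinear br"
    and alternating: "br x x = 0"
    and jacobi: "br x (br y z) + br y (br z x) + br z (br x y) = 0"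
    and fin_dim: "\<exists>B :: 'n set. finite B \<and> span B = UNIV"

fun lower_central_series :: "('n::real_vector \<Rightarrow> 'n \<Rightarrow> 'n) \<Rightarrow> nat \<Rightarrow> 'n set" where
  "lower_central_series br 0 = UNIV"
| "lower_central_series br (Suc k) = span {br x y | x y. y \<in> lower_central_series br k}"

locale nilpotent_lie_algebra = fin_dim_real_lie_algebra +
  assumes nilpotent: "\<exists>k. lower_central_series br k = {0}"

section \<open>Uniform Lie algebras\<close>

text \<open>A uniform basis is given as two indexed families, \<open>v\<close> on \<open>{1..q}\<close> and \<open>z\<close> on \<open>{1..p}\<close>.
  In \<open>colour_count\<close> the pairs are unordered; each one is listed under the
  ordering for which the bracket is \<open>z l\<close>.\<close>

locale uniform_lie_algebra = nilpotent_lie_algebra br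
  for br :: "'n::real_vector \<Rightarrow> 'n \<Rightarrow> 'n" +
  fixes p q r s :: nat and v z :: "nat \<Rightarrow> 'n"
  assumes positive: "0 < p" "0 < q" "0 < r" "0 < s"
    and distinct_basis: "inj_on v {1..q}" "inj_on z {1..p}" "v ` {1..q} \<inter> z ` {1..p} = {}"
    and independent_basis: "independent (v ` {1..q} \<union> z ` {1..p})"
    and spanning_basis: "span (v ` {1..q} \<union> z ` {1..p}) = UNIV"
    and br_v_z: "\<And>i l. i \<in> {1..q} \<Longrightarrow> l \<in> {1..p} \<Longrightarrow> br (v i) (z l) = 0"
    and br_z_z: "\<And>l m. l \<in> {1..p} \<Longrightarrow> m \<in> {1..p} \<Longrightarrow> br (z l) (z m) = 0"
    and br_v_v: "\<And>i j. i \<in> {1..q} \<Longrightarrow> j \<in> {1..q} \<Longrightarrow>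
          br (v i) (v j) \<in> {0} \<union> z ` {1..p} \<union> uminus ` z ` {1..p}"
    and br_cancel: "\<And>i j k. i \<in> {1..q} \<Longrightarrow> j \<in> {1..q} \<Longrightarrow> k \<in> {1..q} \<Longrightarrow>
          br (v i) (v j) \<noteq> 0 \<Longrightarrow>
          br (v i) (v j) = br (v i) (v k) \<or> br (v i) (v j) = - br (v i) (v k) \<Longrightarrow> v j = v k"
    and colour_count: "\<And>l. l \<in> {1..p} \<Longrightarrow>
          card {{v i, v j} | i j. i \<in> {1..q} \<and> j \<in> {1..q} \<and> br (v i) (v j) = z l} = r"
    and degree_count: "\<And>j. j \<in> {1..q} \<Longrightarrow>
          card {v i | i. i \<in> {1..q} \<and> br (v i) (v j) \<noteq> 0} = s"

text \<open>On the arcs of the associated graph the bracket of the two end points is some \<open>z k\<close>,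
  which is by definition the colour; values of the colouring off the arcs play no role.\<close>

definition associated_digraph ::
  "('n::real_vector \<Rightarrow> 'n \<Rightarrow> 'n) \<Rightarrow> nat \<Rightarrow> nat \<Rightarrow> (nat \<Rightarrow> 'n) \<Rightarrow> (nat \<Rightarrow> 'n) \<Rightarrow> 'n pair_pre_digraph"
  where
  "associated_digraph br p q v z =
     \<lparr> pverts = v ` {1..q},
       parcs = {(v i, v j) | i j. i \<in> {1..q} \<and> j \<in> {1..q} \<and> (\<exists>k \<in> {1..p}. br (v i) (v j) = z k)} \<rparr>"

definition associated_colouring :: "('n::real_vector \<Rightarrow> 'n \<Rightarrow> 'n) \<Rightarrow> 'n \<times> 'n \<Rightarrow> 'n" where
  "associated_colouring br e = br (fst e) (snd e)"

section \<open>Uniformly colored graphs\<close>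

text \<open>Undirected simple graphs are given by a set of vertices and a set of two-element edges.\<close>

definition simple_graph :: "'a set \<Rightarrow> 'a set set \<Rightarrow> bool" where
  "simple_graph V E \<longleftrightarrow> finite V \<and> (\<forall>e \<in> E. e \<subseteq> V \<and> card e = 2)"

definition regular_graph :: "'a set \<Rightarrow> 'a set set \<Rightarrow> nat \<Rightarrow> bool" where
  "regular_graph V E s \<longleftrightarrow> simple_graph V E \<and> (\<forall>x \<in> V. card {e \<in> E. x \<in> e} = s)"

definition proper_edge_colouring :: "'a set set \<Rightarrow> ('a set \<Rightarrow> 'c) \<Rightarrow> bool" where
  "proper_edge_colouring E c \<longleftrightarrow>
     (\<forall>e \<in> E. \<forall>f \<in> E. e \<noteq> f \<and> e \<inter> f \<noteq> {} \<longrightarrow> c e \<noteq> c f)"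

definition uniform_edge_colouring ::
  "'a set \<Rightarrow> 'a set set \<Rightarrow> 'c set \<Rightarrow> ('a set \<Rightarrow> 'c) \<Rightarrow> nat \<Rightarrow> nat \<Rightarrow> nat \<Rightarrow> nat \<Rightarrow> bool" where
  "uniform_edge_colouring V E S c p q r s \<longleftrightarrow>
     0 < p \<and> 0 < q \<and> 0 < r \<and> 0 < s \<and>
     regular_graph V E s \<and> card V = q \<and>
     c ` E = S \<and> card S = p \<and>
     proper_edge_colouring E c \<and>
     (\<forall>k \<in> S. card {e \<in> E. c e = k} = r)"

definition orientation_of :: "'a pair_pre_digraph \<Rightarrow> 'a set \<Rightarrow> 'a set set \<Rightarrow> bool" where
  "orientation_of G V E \<longleftrightarrow>
     pair_digraph G \<and> pverts G = V \<and>
     E = {{x, y} | x y. (x, y) \<in> parcs G} \<and>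
     (\<forall>x y. (x, y) \<in> parcs G \<longrightarrow> (y, x) \<notin> parcs G)"

definition uniformly_coloured_digraph ::
  "'a pair_pre_digraph \<Rightarrow> 'c set \<Rightarrow> ('a \<times> 'a \<Rightarrow> 'c) \<Rightarrow> nat \<Rightarrow> nat \<Rightarrow> nat \<Rightarrow> nat \<Rightarrow> bool" where
  "uniformly_coloured_digraph G S c p q r s \<longleftrightarrow>
     (\<exists>V E c'. uniform_edge_colouring V E S c' p q r s \<and> orientation_of G V E \<and>
        (\<forall>(x, y) \<in> parcs G. c (x, y) = c' {x, y}))"

end

theory Submission
  imports Defs
begin

text \<open>The bracket is antisymmetric, and by linear independence \<open>Z\<close> never contains
  both a vector and its negative. So a nonzero bracket of two vectors of \<open>V\<close>, which is
  some \<open>z l\<close> up to sign, lies in \<open>Z\<close> for exactly one order of its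
  arguments: the associated digraph orients the graph in which x and y are joined when
  \<open>br x y\<close> is nonzero (\<open>doubleton_in_edges_iff_br\<close>), and each undirected
  edge inherits a colour (\<open>edge_colour_exists\<close>). The axioms then translate one by one:
  \<open>degree_count\<close> gives regularity (\<open>regular_graph_edges\<close>), while
  \<open>colour_count\<close> gives the sizes of the colour classes and \<open>br_cancel\<close>
  properness (\<open>uniform_edge_colouring_edges\<close>).\<close>

context uniform_lie_algebra
begin

definition V where "V = v ` {1..q}"
definition Z where "Z = z ` {1..p}"
definition arcs where "arcs = {(x, y). x \<in> V \<and> y \<in> V \<and> br x y \<in> Z}"
definition edges where "edges = {{x, y} | x y. (x, y) \<in> arcs}"

lemma br_swap: "br x y = - br y x"
proof -
  have "br (x + y) (x + y) = br x x + br x y + (br y x + br y y)"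
    by (simp only: bilinear_ladd[OF bilinear] bilinear_radd[OF bilinear] ac_simps)
  then show ?thesis
    by (simp add: alternating eq_neg_iff_add_eq_0)
qed

lemma Z_nonzero: "w \<in> Z \<Longrightarrow> w \<noteq> 0"
  unfolding Z_def using independent_basis by (metis UnI2 dependent_zero)

text \<open>If both signs occurred, w would be a multiple of another basis vector. This is what
  prevents arcs in both directions.\<close>

lemma Z_uminus:
  assumes "w \<in> Z" shows "- w \<notin> Z"
proof
  assume neg: "- w \<in> Z"
  \<comment> \<open>Equality would give 2w = 0. Hence \<open>- w\<close> survives the removal of w
    from the basis.\<close>
  have "- w \<noteq> w"
    using Z_nonzero[OF assms] by (simp add: neg_eq_iff_add_eq_0 flip: scaleR_2)
  with neg have "- w \<in> span (V \<union> Z - {w})"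
    by (intro span_base) auto
  then have "w \<in> span (V \<union> Z - {w})"
    using span_neg by fastforce
  moreover have "w \<in> V \<union> Z" using assms by (rule UnI2)
  ultimately have "dependent (V \<union> Z)"
    unfolding dependent_def by (rule bexI)
  with independent_basis show False
    unfolding V_def Z_def by (rule notE)
qed

lemma arcs_iff: "(x, y) \<in> arcs \<longleftrightarrow> x \<in> V \<and> y \<in> V \<and> br x y \<in> Z"
  by (simp add: arcs_def)

lemma arcs_antisym:
  assumes "(x, y) \<in> arcs" shows "(y, x) \<notin> arcs"
proof -
  have "- br x y \<notin> Z" using assms by (intro Z_uminus) (simp add: arcs_iff)
  then show ?thesis by (simp add: arcs_iff br_swap[of y x])
qed

lemma arcs_irrefl: "(x, x) \<notin> arcs"
  using arcs_antisym[of x x] by argo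

lemma doubleton_in_edges: "{x, y} \<in> edges \<longleftrightarrow> (x, y) \<in> arcs \<or> (y, x) \<in> arcs"
  unfolding edges_def by (auto simp: doubleton_eq_iff)

lemma edgesE:
  assumes "e \<in> edges"
  obtains x y where "e = {x, y}" "(x, y) \<in> arcs"
  using assms unfolding edges_def by blast

text \<open>A nonzero bracket has the form z or -z with z in \<open>Z\<close>, and swapping its
  arguments exchanges the two cases. This links edges to \<open>degree_count\<close> and
  \<open>br_cancel\<close>, which speak of nonvanishing brackets only.\<close>

lemma doubleton_in_edges_iff_br:
  "{x, y} \<in> edges \<longleftrightarrow> x \<in> V \<and> y \<in> V \<and> br x y \<noteq> 0"
proof -
  have "br x y \<noteq> 0 \<longleftrightarrow> br x y \<in> Z \<or> br y x \<in> Z" if "x \<in> V" "y \<in> V"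
  proof
    assume "br x y \<noteq> 0"
    moreover have "br x y \<in> {0} \<union> Z \<union> uminus ` Z"
      using that br_v_v unfolding V_def Z_def by blast
    ultimately show "br x y \<in> Z \<or> br y x \<in> Z"
      unfolding br_swap[of y x] by force
  next
    assume "br x y \<in> Z \<or> br y x \<in> Z"
    then show "br x y \<noteq> 0" 
      using Z_nonzero br_swap[of y x] by force
  qed
  then show ?thesis unfolding doubleton_in_edges arcs_iff by blast
qed

lemma edge_at_vertexE:
  assumes "e \<in> edges" "x \<in> e"
  obtains y where "e = {x, y}"
  using assms by (auto elim!: edgesE)

lemma regular_graph_edges: "regular_graph V edges s"
proof -
  have "e \<subseteq> V \<and> card e = 2" if e_edge: "e \<in> edges" for e
  proof -
    obtain x y where e: "e = {x, y}" "(x, y) \<in> arcs" using e_edge by (rule edgesE)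
    then have "x \<noteq> y" using arcs_irrefl by metis
    with e show ?thesis by (simp add: arcs_iff)
  qed
  moreover have "card {e \<in> edges. x \<in> e} = s" if x: "x \<in> V" for x
  proof -
    \<comment> \<open>An edge at x is determined by its other end y; x is put second to match
      \<open>degree_count\<close>.\<close>
    have "{e \<in> edges. x \<in> e} = (\<lambda>y. {y, x}) ` {y \<in> V. br y x \<noteq> 0}" (is "?L = ?R")
    proof
      show "?L \<subseteq> ?R"
      proof
        fix e assume e: "e \<in> ?L"
        then obtain y where y: "e = {y, x}"
          by (metis (lifting) edge_at_vertexE insert_commute mem_Collect_eq)
        with e have "y \<in> V \<and> br y x \<noteq> 0" by (simp add: doubleton_in_edges_iff_br)
        with y show "e \<in> ?R" by blast
      qed
      show "?R \<subseteq> ?L" using x by (auto simp: doubleton_in_edges_iff_br)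
    qed
    moreover have "inj_on (\<lambda>y. {y, x}) {y \<in> V. br y x \<noteq> 0}"
      by (auto simp: inj_on_def doubleton_eq_iff)
    moreover have "{y \<in> V. br y x \<noteq> 0} = {v i | i. i \<in> {1..q} \<and> br (v i) x \<noteq> 0}"
      unfolding V_def by blast
    moreover have "card {v i | i. i \<in> {1..q} \<and> br (v i) x \<noteq> 0} = s"
      using x degree_count unfolding V_def by blast
    ultimately show ?thesis
      by (simp add: card_image)
  qed
  ultimately show ?thesis
    unfolding regular_graph_def simple_graph_def by (simp add: V_def)
qed

text \<open>The bracket along an arc depends only on the underlying edge, since the reversed pair is
  never an arc.\<close>

lemma edge_colour_exists:
  obtains c where "\<And>x y. (x, y) \<in> arcs \<Longrightarrow> c {x, y} = br x y"
proof
  show "(THE w. \<exists>x' y'. (x', y') \<in> arcs \<and> {x, y} = {x', y'} \<and> w = br x' y') = br x y"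
    if "(x, y) \<in> arcs" for x y
    using that arcs_antisym by (intro the_equality) (auto simp: doubleton_eq_iff)
qed

lemma uniform_edge_colouring_edges:
  assumes c: "\<And>x y. (x, y) \<in> arcs \<Longrightarrow> c {x, y} = br x y"
  shows "uniform_edge_colouring V edges Z c p q r s"
proof -
  \<comment> \<open>With the direction of the edge unknown, its colour is the bracket up to sign,
    which is just the ambiguity that \<open>br_cancel\<close> tolerates.\<close>
  have c_edge: "c {x, y} = br x y \<or> c {x, y} = - br x y" if "{x, y} \<in> edges" for x y
    using that c[of x y] c[of y x] br_swap[of y x] unfolding doubleton_in_edges
    by (auto simp: insert_commute)
  have classes: "card {e \<in> edges. c e = w} = r" if w: "w \<in> Z" for w
  proof -
    have "{e \<in> edges. c e = w} = {{x, y} | x y. (x, y) \<in> arcs \<and> br x y = w}"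
      unfolding edges_def using c by (auto 4 4)
    also have "\<dots> = {{x, y} | x y. x \<in> V \<and> y \<in> V \<and> br x y = w}"
      unfolding arcs_iff using w by blast
    also have "\<dots> = {{v i, v j} | i j. i \<in> {1..q} \<and> j \<in> {1..q} \<and> br (v i) (v j) = w}"
      unfolding V_def by blast
    finally show ?thesis using w colour_count by (auto simp: Z_def)
  qed
  have "c ` edges = Z"
  proof
    show "c ` edges \<subseteq> Z" using c by (auto simp: arcs_iff elim!: edgesE)
    show "Z \<subseteq> c ` edges"
    proof
      fix w assume "w \<in> Z"
      \<comment> \<open>Every colour occurs because its class has r > 0 edges.\<close>
      then have "{e \<in> edges. c e = w} \<noteq> {}"
        using classes positive(3) by (metis card.empty less_irrefl)
      then show "w \<in> c ` edges" by blast
    qed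
  qed
  moreover have "proper_edge_colouring edges c"
    unfolding proper_edge_colouring_def
  proof (intro ballI impI notI)
    fix e f assume e: "e \<in> edges" and f: "f \<in> edges"
      and ef: "e \<noteq> f \<and> e \<inter> f \<noteq> {}" and ceq: "c e = c f"
    from ef obtain a where a: "a \<in> e" "a \<in> f" by blast
    obtain b where b: "e = {a, b}" using e a(1) by (rule edge_at_vertexE)
    obtain d where d: "f = {a, d}" using f a(2) by (rule edge_at_vertexE)
    \<comment> \<open>Equal colours at the common vertex a force the brackets to agree up to sign,
      so cancellation identifies the other two ends.\<close>
    have "br a b = br a d \<or> br a b = - br a d"
      using c_edge[of a b] c_edge[of a d] e f ceq unfolding b d by (metis minus_minus)
    moreover have "a \<in> V" "b \<in> V" "br a b \<noteq> 0" "d \<in> V"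
      using e f unfolding b d doubleton_in_edges_iff_br by blast+
    ultimately have "b = d" unfolding V_def using br_cancel by blast
    with ef b d show False by blast
  qed
  moreover have "card V = q" "card Z = p"
    using distinct_basis by (simp_all add: V_def Z_def card_image)
  ultimately show ?thesis
    unfolding uniform_edge_colouring_def
    using positive regular_graph_edges classes by simp
qed

lemma associated_digraph_eq: "associated_digraph br p q v z = \<lparr> pverts = V, parcs = arcs \<rparr>"
proof -
  have "{(v i, v j) | i j. i \<in> {1..q} \<and> j \<in> {1..q} \<and> (\<exists>k \<in> {1..p}. br (v i) (v j) = z k)} = arcs"
    unfolding V_def arcs_def Z_def by blast
  then show ?thesis unfolding associated_digraph_def V_def by simp
qed

lemma orientation_of_associated_digraph:
  "orientation_of (associated_digraph br p q v z) V edges"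
proof -
  have "finite V" by (simp add: V_def)
  moreover from this have "finite arcs"
    by (auto simp: arcs_def intro: finite_subset[of _ "V \<times> V"])
  ultimately have "pair_digraph \<lparr> pverts = V, parcs = arcs \<rparr>"
    using arcs_irrefl by unfold_locales (auto simp: arcs_iff)
  then show ?thesis
    unfolding orientation_of_def associated_digraph_eq using arcs_antisym by (simp add: edges_def)
qed

end

theorem proposition4p6:
  fixes br :: "'n::real_vector \<Rightarrow> 'n \<Rightarrow> 'n"
    and p q r s :: nat
    and v z :: "nat \<Rightarrow> 'n"
  assumes "uniform_lie_algebra br p q r s v z"
  shows "uniformly_coloured_digraph (associated_digraph br p q v z) (z ` {1..p})
           (associated_colouring br) p q r s"
proof -
  interpret uniform_lie_algebra br p q r s v z by (fact assms)
  obtain c where c: "\<And>x y. (x, y) \<in> arcs \<Longrightarrow> c {x, y} = br x y"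
    using edge_colour_exists by blast
  then have "uniform_edge_colouring V edges Z c p q r s"
    by (rule uniform_edge_colouring_edges)
  moreover have "\<forall>(x, y) \<in> parcs (associated_digraph br p q v z).
      associated_colouring br (x, y) = c {x, y}"
    unfolding associated_digraph_eq associated_colouring_def using c by auto
  ultimately show ?thesis
    unfolding uniformly_coloured_digraph_def Z_def[symmetric]
    using orientation_of_associated_digraph by blast
qed

end
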